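(* Let $m$ and $n$ be positive integers with $n$ odd, let $d$ be a positive integer, and put $d'=nd-(n-1)/2$. Then $$\lambda_{mn}^{d'}\ \ge\ |\mathcal{S}_n|^m\,\lambda_m^{d}.$$
   Context: For integers $a\le b$, $[a,b]=\{a,\ldots,b\}$. A Langford sequence of order $m$ and defect $d$ is a sequence $(l_1,\ldots,l_{2m})$ of $2m$ integers such that for every $k\in[d,d+m-1]$ there are exactly two subscripts $i,j\in[1,2m]$ with $l_i=l_j=k$, and these satisfy $|i-j|=k$. $\lambda_M^{D}$ denotes the number of Langford sequences of order $M$ and defect $D$. $\mathcal{S}_n$ denotes the set of all digraphs $S$ with vertex set $[1,n]$ (loops allowed) such that every vertex has exactly one outgoing arc and exactly one incoming arc (a loop at a vertex counts as both), and such that the $n$ numbers $i+j$, for $(i,j)\in E(S)$ (a loop at $i$ giving $2i$), are pairwise distinct and form a set of $n$ consecutive integers. (These are the $1$-regular super edge-magic labeled digraphs of order $n$, with each vertex identified with its label.) *)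

theory Defs
  imports Complex_Main "Graph_Theory.Pair_Digraph"
begin

text \<open>
  Positions in the list are counted from 0 instead of 1; only the difference
  of two positions matters. The condition accounts for all \<open>2 * M\<close> positions,
  so every entry lies in \<open>{D..D + M - 1}\<close> and there are only finitely many
  Langford sequences for given \<open>M\<close> and \<open>D\<close>.
\<close>

definition langford :: "nat \<Rightarrow> int \<Rightarrow> int list \<Rightarrow> bool" where
  "langford M D l \<longleftrightarrow> length l = 2 * M \<and>
     (\<forall>k\<in>{D..D + int M - 1}.
        \<exists>i j. i \<noteq> j \<and> {p. p < 2 * M \<and> l ! p = k} = {i, j} \<and> \<bar>int i - int j\<bar> = k)"

definition num_langford :: "nat \<Rightarrow> int \<Rightarrow> nat" where
  "num_langford M D = card {l. langford M D l}"

text \<open>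
  The 1-regular super edge-magic labeled digraphs of order \<open>n\<close>, each vertex being
  identified with its label. Loops are allowed by \<^locale>\<open>pair_wf_digraph\<close>, and a loop
  counts towards both degrees of its vertex.
\<close>

definition sem_digraphs :: "nat \<Rightarrow> nat pair_pre_digraph set" where
  "sem_digraphs n = {S. pair_wf_digraph S \<and> pverts S = {1..n} \<and>
     (\<forall>v\<in>pverts S. out_degree (with_proj S) v = 1 \<and> in_degree (with_proj S) v = 1) \<and>
     inj_on (\<lambda>(i, j). i + j) (parcs S) \<and>
     (\<exists>a. (\<lambda>(i, j). i + j) ` parcs S = {a..<a + n})}"

end

theory Submission
  imports Defs "HOL-Combinatorics.Permutations" "HOL-Library.FuncSet"
begin

text \<open>
  Write \<open>n = 2 * h + 1\<close>. A digraph in \<open>sem_digraphs n\<close> is the graph of a permutation \<open>f\<close> of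
  \<open>{1..n}\<close>, and summing all arc sums forces the values \<open>a + f a\<close> to fill \<open>{h + 2..3 * h + 2}\<close>.
  Given a Langford sequence and such a permutation \<open>f\<close> for each entry \<open>k\<close>, blow every position up
  to a block of \<open>n\<close> positions and match the \<open>a\<close>-th position of the left block of \<open>k\<close> with the
  \<open>f a\<close>-th position, counted from the right end, of the right block of \<open>k\<close>. The distance of the two
  is \<open>n * k + (n + 1 - a - f a)\<close>, where the second term runs through \<open>{- h..h}\<close>; so each distance
  in the required interval occurs exactly once, and the old sequence and all permutations can be
  read off the new entries by Euclidean division with centred remainder.
\<close>

section \<open>Entries and positions of Langford sequences\<close>

lemma langford_set:
  assumes "langford M D l"
  shows "set l = {D..D + int M - 1}"
proof -
  let ?A = "\<lambda>k. {p. p < 2 * M \<and> l ! p = k}" and ?K = "{D..D + int M - 1}"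
  have len: "length l = 2 * M"
    and A: "\<And>k. k \<in> ?K \<Longrightarrow> \<exists>i j. i \<noteq> j \<and> ?A k = {i, j}"
    using assms unfolding langford_def by blast+
  have card_A: "card (?A k) = 2" if "k \<in> ?K" for k
    using A[OF that] by (metis card_2_iff)
  \<comment> \<open>The \<open>M\<close> disjoint pairs \<open>?A k\<close> already account for all
    \<open>2 * M\<close> positions, so no position is left for a value outside
    \<open>?K\<close>.\<close>
  have "card (\<Union>k\<in>?K. ?A k) = (\<Sum>k\<in>?K. card (?A k))"
    by (rule card_UN_disjoint) auto
  also have "\<dots> = card {..<2 * M}"
    using card_A by simp
  finally have "(\<Union>k\<in>?K. ?A k) = {..<2 * M}"
    by (intro card_subset_eq) auto
  then have "\<exists>k\<in>?K. p \<in> ?A k" if "p < 2 * M" for p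
    using that by blast
  then have "set l \<subseteq> ?K"
    using len by (auto simp: in_set_conv_nth)
  moreover have "k \<in> set l" if k: "k \<in> ?K" for k
  proof -
    obtain i j where "?A k = {i, j}"
      using A[OF k] by blast
    then have "i \<in> ?A k"
      by simp
    then show ?thesis
      using len by (auto simp: in_set_conv_nth)
  qed
  ultimately show ?thesis
    by blast
qed

lemma finite_langford: "finite {l. langford M D l}"
proof (rule finite_subset)
  show "{l. langford M D l} \<subseteq> {l. set l \<subseteq> {D..D + int M - 1} \<and> length l = 2 * M}"
    using langford_set by (auto simp: langford_def)
qed (rule finite_lists_length_eq, simp)

lemma langford_positions:
  assumes "langford M D l" and "k \<in> {D..D + int M - 1}" and "D > 0"
  obtains i j where "i < j" and "j < 2 * M" and "int j = int i + k"
    and "\<forall>p<2 * M. l ! p = k \<longleftrightarrow> p = i \<or> p = j"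
proof -
  obtain i j where ij: "i \<noteq> j" "{p. p < 2 * M \<and> l ! p = k} = {i, j}" "\<bar>int i - int j\<bar> = k"
    using assms(1,2) unfolding langford_def by blast
  have mem: "p < 2 * M \<and> l ! p = k \<longleftrightarrow> p = i \<or> p = j" for p
    using ij(2) by (auto simp: set_eq_iff)
  show thesis
  proof (cases "i < j")
    case True
    show thesis
      by (rule that[of i j]) (use True mem ij(3) in auto)
  next
    case False
    show thesis
      by (rule that[of j i]) (use False mem ij in auto)
  qed
qed

section \<open>From labeled digraphs to permutations\<close>

definition sem_perms :: "nat \<Rightarrow> (nat \<Rightarrow> nat) set" where
  "sem_perms h = {f. f permutes {1..2 * h + 1} \<and>
     (\<lambda>a. a + f a) ` {1..2 * h + 1} = {h + 2..3 * h + 2}}"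

lemma finite_sem_perms: "finite (sem_perms h)"
  by (rule finite_subset[OF _ finite_permutations[of "{1..2 * h + 1}"]]) (auto simp: sem_perms_def)

lemma bij_betw_sem_perms:
  assumes "f \<in> sem_perms h"
  shows "bij_betw (\<lambda>a. a + f a) {1..2 * h + 1} {h + 2..3 * h + 2}"
proof -
  have img: "(\<lambda>a. a + f a) ` {1..2 * h + 1} = {h + 2..3 * h + 2}"
    using assms by (simp add: sem_perms_def)
  moreover have "inj_on (\<lambda>a. a + f a) {1..2 * h + 1}"
  proof (rule eq_card_imp_inj_on)
    show "card ((\<lambda>a. a + f a) ` {1..2 * h + 1}) = card {1..2 * h + 1}"
      unfolding img by simp
  qed simp
  ultimately show ?thesis
    by (simp add: bij_betw_def)
qed

text \<open>Double counting with \<open>n = 2 * h + 1\<close>: since \<open>f\<close> permutes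
  \<open>{1..n}\<close>, the arc sums total twice \<open>1 + ... + n\<close>, which is
  \<open>n * (n + 1)\<close>, while a window of \<open>n\<close> integers from \<open>s\<close> on
  totals \<open>n * (s + h)\<close>.\<close>

lemma sem_window_start:
  fixes f :: "nat \<Rightarrow> nat"
  assumes f: "f permutes {1..2 * h + 1}" and inj: "inj_on (\<lambda>a. a + f a) {1..2 * h + 1}"
    and img: "(\<lambda>a. a + f a) ` {1..2 * h + 1} = {s..<s + (2 * h + 1)}"
  shows "s = h + 2"
proof -
  have "(\<Sum>x = s..<s + (2 * h + 1). x) = (\<Sum>a = 1..2 * h + 1. a + f a)"
    unfolding img[symmetric] by (subst sum.reindex[OF inj]) simp
  also have "\<dots> = 2 * (\<Sum>a = 1..2 * h + 1. a)"
    using sum.permute[OF f, of "\<lambda>a. a"] by (simp add: sum.distrib comp_def)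
  also have "\<dots> = (2 * h + 1) * (2 * h + 2)"
    by (induction h) auto
  finally have "(\<Sum>x = s..<s + (2 * h + 1). x) = (2 * h + 1) * (2 * h + 2)" .
  moreover have "(\<Sum>x = s..<s + (2 * h + 1). x) = (2 * h + 1) * (s + h)"
    by (induction h) (auto simp: algebra_simps)
  ultimately have "s + h = 2 * h + 2"
    by (metis mult_left_cancel add_is_0 one_neq_zero)
  then show ?thesis
    by simp
qed

text \<open>Taking graphs of permutations reaches every digraph: the unique out-arcs define
  \<open>f\<close>, the unique in-arcs make it injective, and finiteness of the vertex set makes it
  a permutation.\<close>

lemma card_sem_digraphs_le: "card (sem_digraphs (2 * h + 1)) \<le> card (sem_perms h)"
proof (rule surj_card_le[OF finite_sem_perms])
  let ?n = "2 * h + 1"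
  let ?G = "\<lambda>f. \<lparr>pverts = {1..?n}, parcs = (\<lambda>a. (a, f a)) ` {1..?n}\<rparr>"
  show "sem_digraphs ?n \<subseteq> ?G ` sem_perms h"
  proof
    fix S assume S: "S \<in> sem_digraphs ?n"
    then interpret pair_wf_digraph S
      by (simp add: sem_digraphs_def)
    from S have V: "pverts S = {1..?n}"
      and deg: "\<And>v. v \<in> {1..?n} \<Longrightarrow>
        out_degree (with_proj S) v = 1 \<and> in_degree (with_proj S) v = 1"
      and inj: "inj_on (\<lambda>(i, j). i + j) (parcs S)"
      by (auto simp: sem_digraphs_def)
    obtain s where s: "(\<lambda>(i, j). i + j) ` parcs S = {s..<s + ?n}"
      using S by (auto simp: sem_digraphs_def)
    have arcs_V: "a \<in> {1..?n} \<and> b \<in> {1..?n}" if "(a, b) \<in> parcs S" for a b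
      using that V in_arcsD1 in_arcsD2 by blast
    have out: "\<exists>!b. (v, b) \<in> parcs S" if "v \<in> {1..?n}" for v
    proof -
      have "card {e \<in> parcs S. fst e = v} = 1"
        using deg[OF that] by (simp add: out_degree_def out_arcs_def)
      then obtain e where "{e \<in> parcs S. fst e = v} = {e}"
        by (auto simp: card_1_singleton_iff)
      then have e: "a \<in> parcs S \<and> fst a = v \<longleftrightarrow> a = e" for a
        by blast
      show ?thesis
      proof (rule ex1I)
        show "(v, snd e) \<in> parcs S"
          using e[of e] by (cases e) simp
        show "b = snd e" if "(v, b) \<in> parcs S" for b
          using e[of "(v, b)"] that by auto
      qed
    qed
    have into: "\<exists>!b. (b, v) \<in> parcs S" if "v \<in> {1..?n}" for v
    proof -
      have "card {e \<in> parcs S. snd e = v} = 1"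
        using deg[OF that] by (simp add: in_degree_def in_arcs_def)
      then obtain e where "{e \<in> parcs S. snd e = v} = {e}"
        by (auto simp: card_1_singleton_iff)
      then have e: "a \<in> parcs S \<and> snd a = v \<longleftrightarrow> a = e" for a
        by blast
      show ?thesis
      proof (rule ex1I)
        show "(fst e, v) \<in> parcs S"
          using e[of e] by (cases e) simp
        show "b = fst e" if "(b, v) \<in> parcs S" for b
          using e[of "(b, v)"] that by auto
      qed
    qed
    \<comment> \<open>The identity outside \<open>{1..?n}\<close> is what \<open>permutes\<close>
      demands.\<close>
    define f where "f v = (if v \<in> {1..?n} then THE b. (v, b) \<in> parcs S else v)" for v
    have f_arc: "(v, f v) \<in> parcs S" if "v \<in> {1..?n}" for v
      using theI'[OF out[OF that]] that by (simp add: f_def)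
    have arcs: "parcs S = (\<lambda>a. (a, f a)) ` {1..?n}"
      using f_arc out arcs_V by fast
    have "inj_on f {1..?n}"
      using f_arc into arcs_V by (intro inj_onI) metis
    moreover have "f ` {1..?n} \<subseteq> {1..?n}"
      using f_arc arcs_V by blast
    ultimately have "bij_betw f {1..?n} {1..?n}"
      by (simp add: bij_betw_def endo_inj_surj)
    then have perm: "f permutes {1..?n}"
      by (rule bij_imp_permutes) (auto simp: f_def)
    have img: "(\<lambda>a. a + f a) ` {1..?n} = {s..<s + ?n}"
      using s unfolding arcs by (simp add: image_image)
    moreover have "inj_on (\<lambda>a. a + f a) {1..?n}"
      using inj unfolding arcs by (auto simp: inj_on_def)
    ultimately have "s = h + 2"
      using sem_window_start perm by blast
    then have "f \<in> sem_perms h"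
      using perm img by (auto simp: sem_perms_def)
    moreover have "S = ?G f"
      using V arcs by (intro pair_pre_digraph.equality) auto
    ultimately show "S \<in> ?G ` sem_perms h"
      by blast
  qed
qed

section \<open>Centred remainders and where they occur\<close>

lemma centred_div_unique:
  fixes x y b c :: int
  assumes "(2 * int h + 1) * x + b = (2 * int h + 1) * y + c" and "\<bar>b\<bar> \<le> int h" and "\<bar>c\<bar> \<le> int h"
  shows "x = y \<and> b = c"
proof -
  \<comment> \<open>The two remainders differ by a multiple of \<open>2 * h + 1\<close> of absolute
    value at most \<open>2 * h\<close>, which must be 0.\<close>
  have *: "(2 * int h + 1) * (x - y) = c - b"
    using assms(1) by (simp add: algebra_simps)
  have "\<bar>c - b\<bar> < 2 * int h + 1"
    using assms(2,3) by linarith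
  then have "c - b = 0"
    using * by (metis dvd_triv_left zdvd_not_zless abs_dvd_iff dvd_abs_iff zero_less_abs_iff)
  then show ?thesis
    using * by auto
qed

text \<open>
  Positions \<open>r\<close> inside a block count from 0, so position \<open>r\<close> is the vertex \<open>Suc r\<close> of the left
  block and, counted from the right end, the vertex \<open>2 * h + 1 - r\<close> of the right block.
\<close>

definition left_rem :: "nat \<Rightarrow> (nat \<Rightarrow> nat) \<Rightarrow> nat \<Rightarrow> int" where
  "left_rem h f r = 2 * int h + 2 - int (Suc r + f (Suc r))"

definition right_rem :: "nat \<Rightarrow> (nat \<Rightarrow> nat) \<Rightarrow> nat \<Rightarrow> int" where
  "right_rem h f r = 2 * int h + 2 - int ((2 * h + 1 - r) + inv f (2 * h + 1 - r))"

lemma sem_perm_inv_sum: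
  assumes "f \<in> sem_perms h" and "b \<in> {1..2 * h + 1}"
  shows "inv f b \<in> {1..2 * h + 1}" and "f (inv f b) = b"
  using assms permutes_in_image[OF permutes_inv] permutes_inverses(1)
  by (fastforce simp: sem_perms_def)+

lemma abs_left_rem:
  assumes "f \<in> sem_perms h" and "r < 2 * h + 1"
  shows "\<bar>left_rem h f r\<bar> \<le> int h"
proof -
  have "Suc r + f (Suc r) \<in> {h + 2..3 * h + 2}"
    using assms by (intro bij_betwE[OF bij_betw_sem_perms, rule_format]) auto
  then show ?thesis
    by (auto simp: left_rem_def)
qed

text \<open>Matched positions carry the same remainder: position \<open>r\<close> of the right block
  is the vertex \<open>f a\<close>, its partner is position \<open>a - 1\<close> of the left block,
  and both use the arc sum \<open>a + f a\<close>. Facts about left blocks thus transfer to right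
  blocks.\<close>

lemma right_rem_eq_left_rem:
  assumes "f \<in> sem_perms h" and "r < 2 * h + 1"
  defines "a \<equiv> inv f (2 * h + 1 - r)"
  shows "a \<in> {1..2 * h + 1}" and "f a = 2 * h + 1 - r" and "right_rem h f r = left_rem h f (a - 1)"
proof -
  show a: "a \<in> {1..2 * h + 1}" "f a = 2 * h + 1 - r"
    using assms sem_perm_inv_sum[of f h "2 * h + 1 - r"] by auto
  then show "right_rem h f r = left_rem h f (a - 1)"
    by (simp add: right_rem_def left_rem_def a_def add.commute)
qed

lemma abs_right_rem:
  assumes "f \<in> sem_perms h" and "r < 2 * h + 1"
  shows "\<bar>right_rem h f r\<bar> \<le> int h"
proof -
  have "inv f (2 * h + 1 - r) - 1 < 2 * h + 1"
    using right_rem_eq_left_rem(1)[OF assms] by auto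
  then show ?thesis
    unfolding right_rem_eq_left_rem(3)[OF assms] by (rule abs_left_rem[OF assms(1)])
qed

text \<open>Exactly one vertex \<open>a\<close> has \<open>a + f a = 2 * h + 2 - e\<close>, as this
  number lies in the window. It gives \<open>r = a - 1\<close> and
  \<open>r' = 2 * h + 1 - f a\<close>, whose difference is \<open>e\<close>.\<close>

lemma rem_positions:
  assumes f: "f \<in> sem_perms h" and e: "\<bar>e\<bar> \<le> int h"
  obtains r r' where "r < 2 * h + 1" and "r' < 2 * h + 1" and "int r' - int r = e"
    and "\<And>q. q < 2 * h + 1 \<Longrightarrow> left_rem h f q = e \<longleftrightarrow> q = r"
    and "\<And>q. q < 2 * h + 1 \<Longrightarrow> right_rem h f q = e \<longleftrightarrow> q = r'"
proof -
  note bij = bij_betw_sem_perms[OF f]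
  have "nat (2 * int h + 2 - e) \<in> {h + 2..3 * h + 2}"
    using e by auto
  then obtain a where a: "a \<in> {1..2 * h + 1}" "nat (2 * int h + 2 - e) = a + f a"
    unfolding bij_betw_imp_surj_on[OF bij, symmetric] by blast
  have sum_a: "int (a + f a) = 2 * int h + 2 - e"
    using a(2) e by auto
  have perm: "f permutes {1..2 * h + 1}"
    using f by (simp add: sem_perms_def)
  have fa: "f a \<in> {1..2 * h + 1}"
    using a(1) permutes_in_image[OF perm] by blast
  have left: "left_rem h f q = e \<longleftrightarrow> q = a - 1" if "q < 2 * h + 1" for q
  proof -
    have "left_rem h f q = e \<longleftrightarrow> Suc q + f (Suc q) = a + f a"
      using sum_a by (auto simp: left_rem_def)
    also have "\<dots> \<longleftrightarrow> Suc q = a"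
      using inj_onD[OF bij_betw_imp_inj_on[OF bij], of "Suc q" a] a(1) that by auto
    finally show ?thesis
      using a(1) by auto
  qed
  have right: "right_rem h f q = e \<longleftrightarrow> q = 2 * h + 1 - f a" if q: "q < 2 * h + 1" for q
  proof -
    define b where "b = inv f (2 * h + 1 - q)"
    have b: "b \<in> {1..2 * h + 1}" "f b = 2 * h + 1 - q" "right_rem h f q = left_rem h f (b - 1)"
      using right_rem_eq_left_rem[OF f q] by (simp_all add: b_def)
    have "right_rem h f q = e \<longleftrightarrow> b - 1 = a - 1"
      unfolding b(3) using b(1) by (intro left) auto
    also have "\<dots> \<longleftrightarrow> b = a"
      using a(1) b(1) by auto
    also have "\<dots> \<longleftrightarrow> f b = f a"
      using permutes_inj[OF perm] by (auto dest: injD)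
    also have "\<dots> \<longleftrightarrow> q = 2 * h + 1 - f a"
      using b(2) fa q by auto
    finally show ?thesis .
  qed
  show thesis
    by (rule that[OF _ _ _ left right]) (use a(1) fa sum_a in auto)
qed

section \<open>The blown-up sequence is a Langford sequence\<close>

definition left_end :: "int list \<Rightarrow> nat \<Rightarrow> bool" where
  "left_end l i \<longleftrightarrow> (\<exists>j>i. j < length l \<and> l ! j = l ! i)"

text \<open>With remainders in \<open>{- h..h}\<close>, the entries that come from \<open>k\<close>
  fill an interval of length \<open>n = 2 * h + 1\<close> centred at \<open>n * k\<close>. The
  intervals of consecutive \<open>k\<close> are adjacent, and the first one starts at the new defect
  \<open>n * D - h\<close>.\<close>

definition blow_up :: "nat \<Rightarrow> (int \<Rightarrow> nat \<Rightarrow> nat) \<Rightarrow> int list \<Rightarrow> int list" where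
  "blow_up h g l = map (\<lambda>p. let i = p div (2 * h + 1); r = p mod (2 * h + 1); k = l ! i in
     (2 * int h + 1) * k + (if left_end l i then left_rem h (g k) r else right_rem h (g k) r))
     [0..<length l * (2 * h + 1)]"

lemma length_blow_up [simp]: "length (blow_up h g l) = length l * (2 * h + 1)"
  by (simp add: blow_up_def)

lemma block_index_less:
  fixes i M n r :: nat
  assumes "i < M" and "r < n"
  shows "i * n + r < M * n"
proof -
  have "i * n + r < Suc i * n"
    using assms(2) by simp
  also have "\<dots> \<le> M * n"
    using assms(1) by (intro mult_le_mono1) simp
  finally show ?thesis .
qed

lemma nth_blow_up:
  assumes "i < length l" and r: "r < 2 * h + 1"
  shows "blow_up h g l ! (i * (2 * h + 1) + r) =
    (2 * int h + 1) * l ! i +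
      (if left_end l i then left_rem h (g (l ! i)) r else right_rem h (g (l ! i)) r)"
proof -
  have "(i * (2 * h + 1) + r) div (2 * h + 1) = i" "(i * (2 * h + 1) + r) mod (2 * h + 1) = r"
    using r by (metis div_mult_self3 add_0_right div_less not_less0 add.commute,
        metis mod_mult_self3 mod_less)
  moreover have "i * (2 * h + 1) + r < length l * (2 * h + 1)"
    by (rule block_index_less) fact+
  ultimately show ?thesis
    by (simp only: blow_up_def nth_map length_upt nth_upt Let_def diff_zero add_0_left)
qed

text \<open>Decoding of an entry by \<open>centred_div_unique\<close>. The block uses
  \<open>g (l ! i)\<close>; the right-hand side may name \<open>g k\<close> because its second
  conjunct matters only when \<open>l ! i = k\<close>.\<close>

lemma nth_blow_up_eq_iff:
  assumes "i < length l" and "r < 2 * h + 1" and "g (l ! i) \<in> sem_perms h" and "\<bar>e\<bar> \<le> int h"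
  shows "blow_up h g l ! (i * (2 * h + 1) + r) = (2 * int h + 1) * k + e \<longleftrightarrow>
    l ! i = k \<and> (if left_end l i then left_rem h (g k) r else right_rem h (g k) r) = e"
proof -
  let ?c = "if left_end l i then left_rem h (g (l ! i)) r else right_rem h (g (l ! i)) r"
  have "\<bar>?c\<bar> \<le> int h"
    using assms abs_left_rem abs_right_rem by simp
  then show ?thesis
    unfolding nth_blow_up[OF assms(1,2)]
    using centred_div_unique[of h "l ! i" ?c k e] assms(4) by auto
qed

text \<open>A value \<open>n * k + e\<close> can occur only in the two blocks of \<open>k\<close>,
  once in each. The blocks are \<open>k\<close> apart and the offsets differ by \<open>e\<close>, so
  the distance is \<open>n * k + e\<close>.\<close>

lemma langford_blow_up:
  assumes l: "langford M D l" and "D > 0"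
    and g: "\<And>k. k \<in> {D..D + int M - 1} \<Longrightarrow> g k \<in> sem_perms h"
  shows "langford (M * (2 * h + 1)) ((2 * int h + 1) * D - int h) (blow_up h g l)"
  unfolding langford_def
proof (intro conjI ballI)
  let ?n = "2 * h + 1" and ?L = "blow_up h g l"
  have len: "length l = 2 * M"
    using l by (simp add: langford_def)
  then show "length ?L = 2 * (M * ?n)"
    by simp
  have gl: "g (l ! i) \<in> sem_perms h" if "i < 2 * M" for i
    using g langford_set[OF l] nth_mem[of i l] len that by auto
  fix v
  assume v: "v \<in> {(2 * int h + 1) * D - int h..
    (2 * int h + 1) * D - int h + int (M * ?n) - 1}"
  \<comment> \<open>Adding \<open>h\<close> before the division and subtracting it from the
    remainder centres the remainder.\<close>
  define k e where "k = (v + int h) div (2 * int h + 1)"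
    and "e = (v + int h) mod (2 * int h + 1) - int h"
  have v_eq: "v = (2 * int h + 1) * k + e"
    using mult_div_mod_eq[of "2 * int h + 1" "v + int h"] unfolding k_def e_def by linarith
  have e: "\<bar>e\<bar> \<le> int h"
    using pos_mod_bound[of "2 * int h + 1" "v + int h"] pos_mod_sign[of "2 * int h + 1" "v + int h"]
    unfolding e_def by linarith
  \<comment> \<open>The range of \<open>v\<close> and the bound on \<open>e\<close> leave less than
    one multiple of \<open>2 * h + 1\<close> of slack on either side, so dividing pins
    \<open>k\<close> to the old range.\<close>
  have "(2 * int h + 1) * D < (2 * int h + 1) * (k + 1)"
    using v v_eq e by (auto simp: algebra_simps)
  moreover have "(2 * int h + 1) * k < (2 * int h + 1) * (D + int M)"
    using v v_eq e by (auto simp: algebra_simps)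
  ultimately have "D < k + 1" "k < D + int M"
    by (simp_all add: mult_less_cancel_left)
  then have k: "k \<in> {D..D + int M - 1}"
    by simp
  obtain i j where ij: "i < j" "j < 2 * M" "int j = int i + k"
    and pos: "\<forall>p<2 * M. l ! p = k \<longleftrightarrow> p = i \<or> p = j"
    using langford_positions[OF l k \<open>D > 0\<close>] by blast
  have l_ij: "l ! i = k" "l ! j = k"
    using pos ij by auto
  have left_i: "left_end l i"
    unfolding left_end_def using ij l_ij len by auto
  have right_j: "\<not> left_end l j"
    unfolding left_end_def l_ij len using pos ij(1) by (metis less_asym less_irrefl)
  obtain r r' where r: "r < ?n" "r' < ?n" "int r' - int r = e"
    and left: "\<And>q. q < ?n \<Longrightarrow> left_rem h (g k) q = e \<longleftrightarrow> q = r"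
    and right: "\<And>q. q < ?n \<Longrightarrow> right_rem h (g k) q = e \<longleftrightarrow> q = r'"
    using rem_positions[OF g[OF k] e] by blast
  have block: "?L ! (b * ?n + q) = v \<longleftrightarrow> b = i \<and> q = r \<or> b = j \<and> q = r'"
    if "b < 2 * M" "q < ?n" for b q
    using nth_blow_up_eq_iff[of b l q h g e k] that len gl[OF that(1)] e pos[rule_format, OF that(1)]
      left_i right_j left[OF that(2)] right[OF that(2)] ij(1)
    unfolding v_eq by auto
  have bounds: "i * ?n + r < 2 * M * ?n" "j * ?n + r' < 2 * M * ?n"
    by (rule block_index_less; use ij r in linarith)+
  have "{p. p < 2 * (M * ?n) \<and> ?L ! p = v} = {i * ?n + r, j * ?n + r'}" (is "?P = ?Q")
  proof
    show "?P \<subseteq> ?Q"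
    proof
      fix p assume "p \<in> ?P"
      then have p: "p < 2 * M * ?n" "?L ! (p div ?n * ?n + p mod ?n) = v"
        by (simp_all only: mult.assoc mem_Collect_eq div_mult_mod_eq)
      have "p div ?n < 2 * M"
        using p(1) by (simp only: less_mult_imp_div_less)
      then have "p div ?n = i \<and> p mod ?n = r \<or> p div ?n = j \<and> p mod ?n = r'"
        using block[of "p div ?n" "p mod ?n"] p(2) by simp
      then show "p \<in> ?Q"
        using div_mult_mod_eq[of p ?n] by (metis insertI1 insertI2)
    qed
    have "?L ! (i * ?n + r) = v" "?L ! (j * ?n + r') = v"
      using block[of i r] block[of j r'] ij r by auto
    then show "?Q \<subseteq> ?P"
      using bounds by (simp only: mult.assoc) blast
  qed
  moreover have "int (j * ?n + r') - int (i * ?n + r) = v"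
    using ij(3) r(3) v_eq by (simp add: algebra_simps)
  \<comment> \<open>Positivity makes the two positions distinct and removes the absolute value. It
    holds because \<open>k\<close> is at least 1 and \<open>e\<close> at least
    \<open>- h\<close>.\<close>
  moreover have "v > 0"
  proof -
    have "2 * int h + 1 \<le> (2 * int h + 1) * k"
      using k \<open>D > 0\<close> by (intro mult_le_cancel_left1[THEN iffD2]) auto
    then show ?thesis
      using v_eq e by linarith
  qed
  ultimately show "\<exists>i j. i \<noteq> j \<and> {p. p < 2 * (M * ?n) \<and> ?L ! p = v} = {i, j} \<and>
      \<bar>int i - int j\<bar> = v"
    by (metis abs_minus_commute abs_of_pos diff_self less_irrefl)
qed

section \<open>Injectivity of the blow-up, and the count\<close>

lemma left_rem_inj:
  assumes "f \<in> sem_perms h" and "f' \<in> sem_perms h"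
    and eq: "\<And>r. r < 2 * h + 1 \<Longrightarrow> left_rem h f r = left_rem h f' r"
  shows "f = f'"
proof
  fix a
  show "f a = f' a"
  proof (cases "a \<in> {1..2 * h + 1}")
    case True
    then show ?thesis
      using eq[of "a - 1"] by (auto simp: left_rem_def)
  next
    case False
    then show ?thesis
      using assms(1,2) unfolding sem_perms_def by (metis (lifting) mem_Collect_eq permutes_not_in)
  qed
qed

text \<open>The centred quotients return \<open>l\<close>, and the remainders in the left block of
  \<open>k\<close> return \<open>g k\<close>. Extensionality of \<open>g\<close> outside the range
  of entries then makes the whole pair recoverable.\<close>

lemma inj_on_blow_up:
  assumes "D > 0"
  shows "inj_on (\<lambda>(g, l). blow_up h g l)
    (({D..D + int M - 1} \<rightarrow>\<^sub>E sem_perms h) \<times> {l. langford M D l})"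
proof (rule inj_onI, clarify)
  let ?K = "{D..D + int M - 1}" and ?n = "2 * h + 1"
  fix g l g' l'
  assume g: "g \<in> ?K \<rightarrow>\<^sub>E sem_perms h" and g': "g' \<in> ?K \<rightarrow>\<^sub>E sem_perms h"
    and l: "langford M D l" and l': "langford M D l'"
    and eq: "blow_up h g l = blow_up h g' l'"
  have len: "length l = 2 * M" "length l' = 2 * M"
    using l l' by (simp_all add: langford_def)
  define c where "c i r = (if left_end l i then left_rem h (g (l ! i)) r
    else right_rem h (g (l ! i)) r)" for i r
  have gl: "g (l ! i) \<in> sem_perms h" "g' (l' ! i) \<in> sem_perms h" if "i < 2 * M" for i
    using that g g' len nth_mem[of i l] nth_mem[of i l'] langford_set[OF l] langford_set[OF l']
    by (metis PiE_mem)+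
  have split: "l' ! i = l ! i \<and> (if left_end l' i then left_rem h (g' (l ! i)) r
    else right_rem h (g' (l ! i)) r) = c i r" if i: "i < 2 * M" and r: "r < ?n" for i r
  proof -
    have "\<bar>c i r\<bar> \<le> int h"
      using gl[OF i] r by (simp add: c_def abs_left_rem abs_right_rem)
    moreover have "blow_up h g' l' ! (i * ?n + r) = (2 * int h + 1) * l ! i + c i r"
      unfolding eq[symmetric] c_def using i r len by (intro nth_blow_up) auto
    ultimately show ?thesis
      using nth_blow_up_eq_iff[of i l' r h g' "c i r" "l ! i"] gl[OF i] i r len by auto
  qed
  have "l' = l"
  proof (rule nth_equalityI)
    show "l' ! i = l ! i" if "i < length l'" for i
      using conjunct1[OF split[of i 0]] that len by simp
  qed (simp add: len)
  \<comment> \<open>Every \<open>k\<close> in \<open>?K\<close> occurs in \<open>l\<close>, so it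
    has a left block from which its permutation can be read.\<close>
  have "g k = g' k" if k: "k \<in> ?K" for k
  proof -
    obtain i j where ij: "i < j" "j < 2 * M" "int j = int i + k"
      and pos: "\<forall>p<2 * M. l ! p = k \<longleftrightarrow> p = i \<or> p = j"
      using langford_positions[OF l k \<open>D > 0\<close>] by blast
    have l_ij: "l ! i = k" "l ! j = k"
      using pos ij by auto
    then have i: "left_end l i" "l ! i = k" "i < 2 * M"
      unfolding left_end_def using ij len by auto
    show ?thesis
    proof (rule left_rem_inj)
      show "g k \<in> sem_perms h" "g' k \<in> sem_perms h"
        using PiE_mem[OF g k] PiE_mem[OF g' k] .
      show "left_rem h (g k) r = left_rem h (g' k) r" if "r < ?n" for r
        using split[OF i(3) that] i \<open>l' = l\<close> by (simp add: c_def)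
    qed
  qed
  then have "g = g'"
    using PiE_ext[OF g g'] by blast
  with \<open>l' = l\<close> show "g = g' \<and> l = l'"
    by simp
qed

theorem theorem3p3:
  fixes m n :: nat and d :: int
  assumes "m > 0" and "n > 0" and "odd n" and "d > 0"
  shows "num_langford (m * n) (int n * d - (int n - 1) div 2)
           \<ge> card (sem_digraphs n) ^ m * num_langford m d"
proof -
  obtain h where n: "n = 2 * h + 1"
    using \<open>odd n\<close> by (rule oddE)
  let ?K = "{d..d + int m - 1}" and ?D = "(2 * int h + 1) * d - int h"
  have D: "int n * d - (int n - 1) div 2 = ?D"
    by (simp add: n add.commute)
  have "card (sem_digraphs n) ^ m * num_langford m d \<le> card (sem_perms h) ^ m * num_langford m d"
    unfolding n using card_sem_digraphs_le by (intro mult_le_mono1 power_mono) auto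
  \<comment> \<open>One independent choice of a permutation for each of the \<open>m\<close> values
    of \<open>?K\<close> accounts for the power.\<close>
  also have "\<dots> = card ((?K \<rightarrow>\<^sub>E sem_perms h) \<times> {l. langford m d l})"
    by (simp add: card_cartesian_product card_PiE num_langford_def)
  also have "\<dots> \<le> card {L. langford (m * (2 * h + 1)) ?D L}"
  proof (rule card_inj_on_le[OF inj_on_blow_up[OF \<open>d > 0\<close>] _ finite_langford])
    show "(\<lambda>(g, l). blow_up h g l) ` ((?K \<rightarrow>\<^sub>E sem_perms h) \<times> {l. langford m d l})
        \<subseteq> {L. langford (m * (2 * h + 1)) ?D L}"
      using langford_blow_up[OF _ \<open>d > 0\<close>] PiE_mem by fast
  qed
  finally show ?thesis
    unfolding num_langford_def D unfolding n .
qed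

end
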